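(* Let $N,k,s,t,n>0$ be integers, let $\mathbb{S}$ be a set of $s$ symbols, let $\mathbb{R}$ be a finite commutative ring with identity, and let $\boldsymbol\alpha=(\alpha_1,\ldots,\alpha_n)$ be $n$ functions $\alpha_1,\ldots,\alpha_n:\mathbb{S}\to\mathbb{R}$. If there exists an $\mathsf{FOASC}(N,k,s,t;\boldsymbol\alpha)$ (a family of orthogonal arrays with $\boldsymbol\alpha$-span capability), then there exists a $t$-private $k$-server private information retrieval protocol ($(t,k)$-PIR protocol) $\mathcal{P}$ for databases $\boldsymbol x\in\{0,1\}^n$ with communication complexity $$\mathbf{C}_{\mathcal P}(n,k)=k\left(\log|\mathbb{S}|+\log|\mathbb{R}|\right).$$
   Context: **Notation.** $[n]=\{1,\ldots,n\}$. $\boldsymbol e_n^{(i)}$ is the length-$n$ unit vector whose $i$th entry is $1$ and all other entries are $0$. For a matrix $\boldsymbol Q$, $Q_{i,j}$ is its $(i,j)$-entry. Logarithms are to base 2. **Orthogonal arrays.** Let $\mathbb{S}$ be a set of $s$ symbols (levels). An $N\times k$ array (matrix with $N$ rows and $k$ columns) $\boldsymbol Q$ with entries in $\mathbb{S}$ is an orthogonal array of level $s$, strength $t$ (with $t\le k$) and index $\lambda$, written $\mathsf{OA}(N,k,s,t)$, if every $N\times t$ subarray of $\boldsymbol Q$ (a submatrix consisting of $t$ columns of $\boldsymbol Q$) contains every element of $\mathbb{S}^t$ exactly $\lambda$ times as a row. **FOASC.** Let $\mathbb{S}$ be a set of $s$ levels, $\mathbb{R}$ a commutative ring with identity, and $\boldsymbol\alpha=(\alpha_1,\ldots,\alpha_n)$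 functions with domain $\mathbb{S}$ and range (codomain) $\mathbb{R}$. A set $\{\boldsymbol Q^{(1)},\ldots,\boldsymbol Q^{(n)}\}$ (indexed by $i\in[n]$) of $\mathsf{OA}(N,k,s,t)$'s over $\mathbb{S}$ is a family of orthogonal arrays with $\boldsymbol\alpha$-span capability, written $\mathsf{FOASC}(N,k,s,t;\boldsymbol\alpha)$, if for all $i\in[n]$ and $\ell\in[N]$ the columns of the $n\times k$ matrix $\boldsymbol\alpha(\boldsymbol Q^{(i)}_\ell)$ over $\mathbb{R}$, whose $(\tau,j)$-entry is $\alpha_\tau(Q^{(i)}_{\ell,j})$ for $\tau\in[n]$, $j\in[k]$, span a nonzero multiple of $\boldsymbol e_n^{(i)}$; that is, there exist $\boldsymbol\lambda^{(i)}_\ell\in\mathbb{R}^k$ (a column vector) and a nonzero $\omega^{(i)}_\ell\in\mathbb{R}$ with $\boldsymbol\alpha(\boldsymbol Q^{(i)}_\ell)\cdot\boldsymbol\lambda^{(i)}_\ell=\omega^{(i)}_\ell\,\boldsymbol e_n^{(i)}$ (with $\boldsymbol e_n^{(i)}$ regarded as a column vector). Here $\boldsymbol Q^{(i)}_\ell$ is the $\ell$th row of $\boldsymbol Q^{(i)}$. **PIR.** A $t$-private $k$-server private information retrieval ($(t,k)$-PIR) protocol $\mathcal{P}=(\mathcal{Q},\mathcal{A},\mathcal{C})$ consists of three algorithms: - $(q_1,\ldots,q_k,\mathsf{aux})\leftarrow\mathcal{Q}(k,n,i)$: a randomized querying algorithm that takes the public parameters $k,n$ and the user's private retrieval index $i\in[n]$,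 and outputs $k$ queries $q_1,\ldots,q_k$ and an auxiliary information string $\mathsf{aux}$ (kept by the user for reconstruction). - $a_j\leftarrow\mathcal{A}(k,j,\boldsymbol x,q_j)$: a deterministic answering algorithm that takes the database $\boldsymbol x=(x_1,\ldots,x_n)\in\{0,1\}^n$ and the query $q_j$, and outputs an answer $a_j$. - $x_i\leftarrow\mathcal{C}(k,n,a_1,\ldots,a_k,\mathsf{aux})$: a deterministic reconstructing algorithm that takes $\mathsf{aux}$ and the $k$ answers and outputs the target entry. The following two requirements must hold. - Correctness: for any $\boldsymbol x\in\{0,1\}^n$, any $i\in[n]$, any output $(q_1,\ldots,q_k,\mathsf{aux})\leftarrow\mathcal{Q}(k,n,i)$, and $a_j\leftarrow\mathcal{A}(k,j,\boldsymbol x,q_j)$ for $j\in[k]$, one has $\mathcal{C}(k,n,a_1,\ldots,a_k,\mathsf{aux})=x_i$. - $t$-Privacy: for any $i_1,i_2\in[n]$ and any subset $T\subseteq[k]$ of size $\le t$, the distributions of $\mathcal{Q}_T(k,n,i_1)$ and $\mathcal{Q}_T(k,n,i_2)$ are identical, where $\mathcal{Q}_T$ denotes the concatenation of the $j$-th outputs (queries $q_j$) of $\mathcal{Q}$ for all $j\in T$. **Communication complexity.** The user sends $q_j$ to server $j$ and server $j$ returns $a_j$, for each $j\in[k]$. The communication complexity $\mathbf{C}_{\mathcal P}(n,k)$ is the total number of bits communicated between the user and the $k$ servers, maximized over all databases $\boldsymbol x\in\{0,1\}^n$, retrieval indices $i\in[n]$, and random coins of $\mathcal{Q}$. By convention,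 sending an element of a finite set $X$ (the query space or answer space) costs $\log|X|$ bits (no rounding). Thus if every query lies in a query space $X$ and every answer in an answer space $Y$, the communication complexity is $k(\log|X|+\log|Y|)$. *)

theory Defs
  imports "HOL-Algebra.Ring" "HOL-Probability.Probability_Mass_Function"
begin

text \<open>
  Arrays, vectors and tuples indexed by an initial segment \<open>{1..m}\<close> are functions on
  \<open>nat\<close> of which only the values on that segment matter.  Wherever such a tuple is
  passed on to another party or compared with another one, it is cut down with
  \<^const>\<open>restrict\<close>, so that nothing outside the index set can carry information.
\<close>

definition orthogonal_array ::
  "'s set \<Rightarrow> nat \<Rightarrow> nat \<Rightarrow> nat \<Rightarrow> nat \<Rightarrow> (nat \<Rightarrow> nat \<Rightarrow> 's) \<Rightarrow> bool" where
  "orthogonal_array S N k s t Q \<longleftrightarrow>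
     finite S \<and> card S = s \<and> t \<le> k \<and>
     (\<forall>l\<in>{1..N}. \<forall>j\<in>{1..k}. Q l j \<in> S) \<and>
     (\<exists>ind. \<forall>J. J \<subseteq> {1..k} \<and> card J = t \<longrightarrow>
        (\<forall>v \<in> J \<rightarrow>\<^sub>E S. card {l \<in> {1..N}. restrict (Q l) J = v} = ind))"

text \<open>
  \<open>Q i l j\<close> is the \<open>(l, j)\<close>-entry of the \<open>i\<close>-th array.  The last equation
  is the \<open>\<tau>\<close>-th coordinate of the condition that the matrix with entries
  \<open>\<alpha> \<tau> (Q i l j)\<close>, applied to the column vector \<open>c\<close>, gives \<open>w\<close> times
  the \<open>i\<close>-th unit vector.
\<close>

definition foasc ::
  "('r, 'm) ring_scheme \<Rightarrow> 's set \<Rightarrow> nat \<Rightarrow> nat \<Rightarrow> nat \<Rightarrow> nat \<Rightarrow> nat \<Rightarrow> (nat \<Rightarrow> 's \<Rightarrow> 'r)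
    \<Rightarrow> (nat \<Rightarrow> nat \<Rightarrow> nat \<Rightarrow> 's) \<Rightarrow> bool" where
  "foasc R S N k s t n \<alpha> Q \<longleftrightarrow>
     (\<forall>i\<in>{1..n}. orthogonal_array S N k s t (Q i)) \<and>
     (\<forall>i\<in>{1..n}. \<forall>l\<in>{1..N}.
        \<exists>c \<in> {1..k} \<rightarrow> carrier R. \<exists>w \<in> carrier R. w \<noteq> \<zero>\<^bsub>R\<^esub> \<and>
          (\<forall>\<tau>\<in>{1..n}. (\<Oplus>\<^bsub>R\<^esub>j\<in>{1..k}. \<alpha> \<tau> (Q i l j) \<otimes>\<^bsub>R\<^esub> c j)
                        = w \<otimes>\<^bsub>R\<^esub> (if \<tau> = i then \<one>\<^bsub>R\<^esub> else \<zero>\<^bsub>R\<^esub>)))"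

definition databases :: "nat \<Rightarrow> (nat \<Rightarrow> nat) set" where
  "databases n = {1..n} \<rightarrow>\<^sub>E {0, 1}"

text \<open>
  The arguments of the components are, in order: \<open>k n\<close> (spaces), \<open>k n i\<close> (querying),
  \<open>k j x q\<^sub>j\<close> (answering) and \<open>k n (a\<^sub>1, \<dots>, a\<^sub>k) aux\<close> (reconstructing).
  The spaces are part of a protocol because they determine its communication cost.
\<close>

record ('q, 'a, 'aux) pir_protocol =
  query_space :: "nat \<Rightarrow> nat \<Rightarrow> 'q set"
  answer_space :: "nat \<Rightarrow> nat \<Rightarrow> 'a set"
  querying :: "nat \<Rightarrow> nat \<Rightarrow> nat \<Rightarrow> ((nat \<Rightarrow> 'q) \<times> 'aux) pmf"
  answering :: "nat \<Rightarrow> nat \<Rightarrow> (nat \<Rightarrow> nat) \<Rightarrow> 'q \<Rightarrow> 'a"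
  reconstructing :: "nat \<Rightarrow> nat \<Rightarrow> (nat \<Rightarrow> 'a) \<Rightarrow> 'aux \<Rightarrow> nat"

definition pir_well_typed :: "('q, 'a, 'aux) pir_protocol \<Rightarrow> nat \<Rightarrow> nat \<Rightarrow> bool" where
  "pir_well_typed P k n \<longleftrightarrow>
     finite (query_space P k n) \<and> finite (answer_space P k n) \<and>
     (\<forall>i\<in>{1..n}. \<forall>(q, aux) \<in> set_pmf (querying P k n i). q \<in> {1..k} \<rightarrow>\<^sub>E query_space P k n) \<and>
     (\<forall>j\<in>{1..k}. \<forall>x \<in> databases n. \<forall>q \<in> query_space P k n.
        answering P k j x q \<in> answer_space P k n)"

definition pir_correct :: "('q, 'a, 'aux) pir_protocol \<Rightarrow> nat \<Rightarrow> nat \<Rightarrow> bool" where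
  "pir_correct P k n \<longleftrightarrow>
     (\<forall>x \<in> databases n. \<forall>i\<in>{1..n}. \<forall>(q, aux) \<in> set_pmf (querying P k n i).
        reconstructing P k n (\<lambda>j\<in>{1..k}. answering P k j x (q j)) aux = x i)"

definition pir_private :: "('q, 'a, 'aux) pir_protocol \<Rightarrow> nat \<Rightarrow> nat \<Rightarrow> nat \<Rightarrow> bool" where
  "pir_private P t k n \<longleftrightarrow>
     (\<forall>i1\<in>{1..n}. \<forall>i2\<in>{1..n}. \<forall>T. T \<subseteq> {1..k} \<and> card T \<le> t \<longrightarrow>
        map_pmf (\<lambda>(q, aux). restrict q T) (querying P k n i1) =
        map_pmf (\<lambda>(q, aux). restrict q T) (querying P k n i2))"

definition is_pir :: "nat \<Rightarrow> nat \<Rightarrow> nat \<Rightarrow> ('q, 'a, 'aux) pir_protocol \<Rightarrow> bool" where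
  "is_pir t k n P \<longleftrightarrow> pir_well_typed P k n \<and> pir_correct P k n \<and> pir_private P t k n"

text \<open>
  Sending an element \<open>m\<close> of a finite set \<open>X\<close> costs \<open>log |X|\<close> bits, without
  rounding and whatever \<open>m\<close> is; so the maximum below is over a singleton set
  if \<open>n > 0\<close>.
\<close>

definition sending_cost :: "'b set \<Rightarrow> 'b \<Rightarrow> real" where
  "sending_cost X m = log 2 (real (card X))"

definition transcript_cost ::
  "('q, 'a, 'aux) pir_protocol \<Rightarrow> nat \<Rightarrow> nat \<Rightarrow> (nat \<Rightarrow> nat) \<Rightarrow> (nat \<Rightarrow> 'q) \<Rightarrow> real" where
  "transcript_cost P n k x q =
     (\<Sum>j\<in>{1..k}. sending_cost (query_space P k n) (q j)
                 + sending_cost (answer_space P k n) (answering P k j x (q j)))"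

definition communication_complexity ::
  "('q, 'a, 'aux) pir_protocol \<Rightarrow> nat \<Rightarrow> nat \<Rightarrow> real" where
  "communication_complexity P n k =
     Max {transcript_cost P n k x q | x i q aux.
            x \<in> databases n \<and> i \<in> {1..n} \<and> (q, aux) \<in> set_pmf (querying P k n i)}"

end

(*
  The user picks a uniformly random row l of the i-th array and sends its j-th entry to
  server j, which answers with a_j, the sum over tau of x_tau alpha_tau(q_j).  With c, w as in
  the span condition for this row, sum_j a_j c_j = x_i w, which vanishes exactly when x_i = 0;
  thus R may have zero divisors and w need not be invertible.  Privacy holds because by strength
  t any t entries of a random row are uniformly distributed on S^t, whatever the array.
*)
theory Submission
  imports Defs "HOL-Library.Nat_Bijection"
begin

text \<open>Counting \<open>A\<close> fibre by fibre gives \<open>card A = card B * m\<close>, so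
  each point of \<open>B\<close> receives mass \<open>m / card A = 1 / card B\<close>.\<close>

lemma map_pmf_of_set_const_fibres:
  assumes fin: "finite A" "A \<noteq> {}" "finite B" and img: "f ` A \<subseteq> B"
    and fib: "\<And>v. v \<in> B \<Longrightarrow> card {a \<in> A. f a = v} = m"
  shows "map_pmf f (pmf_of_set A) = pmf_of_set B"
proof (rule pmf_eqI)
  fix v
  have "(\<Sum>v\<in>B. card {a \<in> A. f a = v}) = card A"
    using sum.group[OF fin(1,3) img, of "\<lambda>_. 1::nat"] by simp
  then have A: "card A = card B * m"
    using fib by simp
  have "B \<noteq> {}"
    using fin img by auto
  have "card A > 0"
    using fin by auto
  have v: "pmf (map_pmf f (pmf_of_set A)) v = card {a \<in> A. f a = v} / card A"
    using fin by (simp add: pmf_map measure_pmf_of_set Int_def vimage_def)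
  show "pmf (map_pmf f (pmf_of_set A)) v = pmf (pmf_of_set B) v"
  proof (cases "v \<in> B")
    case True
    then show ?thesis
      using A \<open>card A > 0\<close> \<open>B \<noteq> {}\<close> fin by (simp add: v fib)
  next
    case False
    then have "{a \<in> A. f a = v} = {}"
      using img by auto
    then have "card {a \<in> A. f a = v} = 0"
      by (simp only: card.empty)
    then show ?thesis
      using False \<open>B \<noteq> {}\<close> fin by (simp add: v)
  qed
qed

text \<open>The index \<open>ind\<close> of the array is the common size of the fibres of the map
  from row numbers to subrows, so these fibres are constant over
  \<open>J \<rightarrow>\<^sub>E S\<close>.\<close>

lemma orthogonal_array_uniform:
  assumes Q: "orthogonal_array S N k s t Q" and N: "N > 0"
    and J: "J \<subseteq> {1..k}" "card J = t"
  shows "map_pmf (\<lambda>l. restrict (Q l) J) (pmf_of_set {1..N}) = pmf_of_set (J \<rightarrow>\<^sub>E S)"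
proof -
  have S: "finite S" and entries: "\<forall>l\<in>{1..N}. \<forall>j\<in>{1..k}. Q l j \<in> S"
    using Q unfolding orthogonal_array_def by simp_all
  obtain ind where "\<forall>J. J \<subseteq> {1..k} \<and> card J = t \<longrightarrow>
      (\<forall>v \<in> J \<rightarrow>\<^sub>E S. card {l \<in> {1..N}. restrict (Q l) J = v} = ind)"
    using Q unfolding orthogonal_array_def by (elim conjE exE)
  then have ind: "card {l \<in> {1..N}. restrict (Q l) J = v} = ind" if "v \<in> J \<rightarrow>\<^sub>E S" for v
    using J that by (simp only: simp_thms)
  have img: "(\<lambda>l. restrict (Q l) J) ` {1..N} \<subseteq> J \<rightarrow>\<^sub>E S"
    using entries J(1) by auto
  have "finite J"
    using J(1) finite_subset by blast
  then have "finite (J \<rightarrow>\<^sub>E S)"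
    using S by (intro finite_PiE)
  then show ?thesis
    using N by (intro map_pmf_of_set_const_fibres[OF _ _ _ img ind]) simp_all
qed

text \<open>Strength speaks of exactly \<open>t\<close> columns. Since \<open>t \<le> k\<close>, a
  smaller \<open>T\<close> extends to a set \<open>J\<close> of \<open>t\<close> columns, and the
  distribution on \<open>T\<close> is a marginal of the one on \<open>J\<close>, which is uniform
  for both arrays.\<close>

lemma orthogonal_array_subrow_distr_eq:
  assumes Q: "orthogonal_array S N k s t Q" "orthogonal_array S N k s t Q'" and N: "N > 0"
    and T: "T \<subseteq> {1..k}" "card T \<le> t"
  shows "map_pmf (\<lambda>l. restrict (Q l) T) (pmf_of_set {1..N}) =
         map_pmf (\<lambda>l. restrict (Q' l) T) (pmf_of_set {1..N})"
proof -
  have "t \<le> card {1..k}"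
    using Q unfolding orthogonal_array_def by simp
  then obtain J where J: "T \<subseteq> J" "J \<subseteq> {1..k}" "card J = t"
    using exists_subset_between[OF T(2) _ T(1)] by auto
  have "map_pmf (\<lambda>l. restrict (P l) T) (pmf_of_set {1..N}) =
        map_pmf (\<lambda>q. restrict q T) (map_pmf (\<lambda>l. restrict (P l) J) (pmf_of_set {1..N}))"
    for P :: "nat \<Rightarrow> nat \<Rightarrow> 'a"
    using J(1) by (simp add: pmf.map_comp o_def restrict_restrict Int_absorb1)
  then show ?thesis
    using orthogonal_array_uniform[OF Q(1) N J(2,3)] orthogonal_array_uniform[OF Q(2) N J(2,3)]
    by metis
qed

text \<open>For exchanging the sum over servers with the sum over database positions.\<close>

lemma (in abelian_monoid) finsum_finsum_swap:
  assumes "finite A" "finite B" "\<And>a b. a \<in> A \<Longrightarrow> b \<in> B \<Longrightarrow> g a b \<in> carrier G"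
  shows "(\<Oplus>a\<in>A. \<Oplus>b\<in>B. g a b) = (\<Oplus>b\<in>B. \<Oplus>a\<in>A. g a b)"
  using assms(1,3)
proof (induction A rule: finite_induct)
  case empty
  then show ?case by simp
next
  case (insert a A)
  have "(\<Oplus>a\<in>insert a A. \<Oplus>b\<in>B. g a b) = (\<Oplus>b\<in>B. g a b) \<oplus> (\<Oplus>b\<in>B. \<Oplus>a\<in>A. g a b)"
    using insert by (subst finsum_insert) (auto intro!: finsum_closed)
  also have "\<dots> = (\<Oplus>b\<in>B. g a b \<oplus> (\<Oplus>a\<in>A. g a b))"
    using insert by (intro finsum_addf[symmetric]) (auto intro!: finsum_closed)
  also have "\<dots> = (\<Oplus>b\<in>B. \<Oplus>a\<in>insert a A. g a b)"
    using insert by (intro finsum_cong') (auto intro!: finsum_closed)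
  finally show ?case .
qed

text \<open>Associativity of the matrix product: \<open>(b M) c = b (M c)\<close>, and
  \<open>M c\<close> is \<open>w\<close> times the unit vector at \<open>i\<close>. In the protocol
  \<open>b\<close> holds the database bits and \<open>b M\<close> the answers.\<close>

lemma (in cring) span_unit_vector_extracts:
  assumes fin: "finite I" "finite J" and i: "i \<in> I"
    and M: "\<And>\<tau> j. \<tau> \<in> I \<Longrightarrow> j \<in> J \<Longrightarrow> M \<tau> j \<in> carrier R"
    and b: "b \<in> I \<rightarrow> carrier R" and c: "c \<in> J \<rightarrow> carrier R" and w: "w \<in> carrier R"
    and span: "\<And>\<tau>. \<tau> \<in> I \<Longrightarrow> (\<Oplus>j\<in>J. M \<tau> j \<otimes> c j) = w \<otimes> (if \<tau> = i then \<one> else \<zero>)"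
  shows "(\<Oplus>j\<in>J. (\<Oplus>\<tau>\<in>I. b \<tau> \<otimes> M \<tau> j) \<otimes> c j) = b i \<otimes> w"
proof -
  have cl: "b \<tau> \<in> carrier R" "c j \<in> carrier R" "M \<tau> j \<in> carrier R" if "\<tau> \<in> I" "j \<in> J" for \<tau> j
    using that b c M by auto
  have "(\<Oplus>j\<in>J. (\<Oplus>\<tau>\<in>I. b \<tau> \<otimes> M \<tau> j) \<otimes> c j) = (\<Oplus>j\<in>J. \<Oplus>\<tau>\<in>I. b \<tau> \<otimes> (M \<tau> j \<otimes> c j))"
    \<comment> \<open>\<open>cl\<close> gives \<open>c j \<in> carrier R\<close> only in the
      presence of some element of \<open>I\<close>; \<open>i\<close> serves as one.\<close>
    using cl fin i
    by (intro finsum_cong') (auto simp: finsum_ldistr m_assoc intro!: finsum_closed finsum_cong')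
  also have "\<dots> = (\<Oplus>\<tau>\<in>I. \<Oplus>j\<in>J. b \<tau> \<otimes> (M \<tau> j \<otimes> c j))"
    using cl fin by (intro finsum_finsum_swap) auto
  \<comment> \<open>The equation is turned round to \<open>i = \<tau>\<close> to fit
    \<open>finsum_singleton\<close>.\<close>
  also have "\<dots> = (\<Oplus>\<tau>\<in>I. if i = \<tau> then b \<tau> \<otimes> w else \<zero>)"
  proof (intro finsum_cong')
    fix \<tau> assume \<tau>: "\<tau> \<in> I"
    have "(\<Oplus>j\<in>J. b \<tau> \<otimes> (M \<tau> j \<otimes> c j)) = b \<tau> \<otimes> (\<Oplus>j\<in>J. M \<tau> j \<otimes> c j)"
      using \<tau> b M c fin by (intro finsum_rdistr[symmetric]) auto
    then show "(\<Oplus>j\<in>J. b \<tau> \<otimes> (M \<tau> j \<otimes> c j)) = (if i = \<tau> then b \<tau> \<otimes> w else \<zero>)"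
      using \<tau> w funcset_mem[OF b \<tau>] by (auto simp: span)
  qed (use funcset_mem[OF b] w in auto)
  also have "\<dots> = b i \<otimes> w"
    using fin i b w by (intro finsum_singleton) auto
  finally show ?thesis .
qed

text \<open>The cost of a message depends only on its space, so all transcripts cost the same and
  \<open>Max\<close> is taken over a singleton once some transcript exists.\<close>

lemma communication_complexity_eq:
  assumes "n > 0"
  shows "communication_complexity P n k =
    real k * (log 2 (real (card (query_space P k n))) + log 2 (real (card (answer_space P k n))))"
    (is "_ = ?c")
proof -
  have cost: "transcript_cost P n k x q = ?c" for x q
    by (simp add: transcript_cost_def sending_cost_def)
  \<comment> \<open>A transcript exists: the zero database, index 1 and any outcome in the support
    of the query distribution.\<close>
  have "(\<lambda>_\<in>{1..n}. 0) \<in> databases n"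
    by (simp add: databases_def)
  moreover obtain q aux where "(q, aux) \<in> set_pmf (querying P k n 1)"
    by (metis all_not_in_conv set_pmf_not_empty surj_pair)
  moreover have "(1::nat) \<in> {1..n}"
    using assms by simp
  ultimately have "{?c | x i q aux.
      x \<in> databases n \<and> i \<in> {1..n} \<and> (q, aux) \<in> set_pmf (querying P k n i)} = {?c}"
    by blast
  then show ?thesis
    by (simp only: communication_complexity_def cost Max_singleton)
qed

theorem theorem1:
  fixes N k s t n :: nat
    and S :: "'s set"
    and R :: "('r, 'm) ring_scheme"
    and \<alpha> :: "nat \<Rightarrow> 's \<Rightarrow> 'r"
  assumes "N > 0" "k > 0" "s > 0" "t > 0" "n > 0"
    and "finite S" "card S = s"
    and "cring R" "finite (carrier R)"
    and "\<forall>\<tau>\<in>{1..n}. \<alpha> \<tau> \<in> S \<rightarrow> carrier R"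
    and "\<exists>Q. foasc R S N k s t n \<alpha> Q"
  shows "\<exists>P :: ('s, 'r, bool list) pir_protocol.
           is_pir t k n P \<and>
           communication_complexity P n k
             = real k * (log 2 (real (card S)) + log 2 (real (card (carrier R))))"
proof -
  interpret cring R by fact
  have \<alpha>: "\<alpha> \<tau> u \<in> carrier R" if "\<tau> \<in> {1..n}" "u \<in> S" for \<tau> u
    using assms(10) that by auto
  obtain Q where Q: "foasc R S N k s t n \<alpha> Q"
    using assms(11) by blast
  have OA: "orthogonal_array S N k s t (Q i)" if "i \<in> {1..n}" for i
    using Q that unfolding foasc_def by blast
  then have QS: "Q i l j \<in> S" if "i \<in> {1..n}" "l \<in> {1..N}" "j \<in> {1..k}" for i l j
    using that unfolding orthogonal_array_def by blast
  define spans where "spans i l c \<longleftrightarrow> c \<in> {1..k} \<rightarrow> carrier R \<and> (\<exists>w \<in> carrier R. w \<noteq> \<zero>\<^bsub>R\<^esub> \<and>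
      (\<forall>\<tau>\<in>{1..n}. (\<Oplus>\<^bsub>R\<^esub>j\<in>{1..k}. \<alpha> \<tau> (Q i l j) \<otimes>\<^bsub>R\<^esub> c j)
                    = w \<otimes>\<^bsub>R\<^esub> (if \<tau> = i then \<one>\<^bsub>R\<^esub> else \<zero>\<^bsub>R\<^esub>)))" for i l c
  \<comment> \<open>Fixing the coefficients as a function of \<open>i\<close> and \<open>l\<close>
    lets the user recover them from these two numbers alone.\<close>
  define C where "C i l = (SOME c. spans i l c)" for i l
  have C: "spans i l (C i l)" if "i \<in> {1..n}" "l \<in> {1..N}" for i l
  proof -
    have "\<exists>c. spans i l c"
      using Q that unfolding foasc_def spans_def by blast
    then show ?thesis
      unfolding C_def by (rule someI_ex)
  qed
  \<comment> \<open>Database bits are natural numbers and have to be embedded in the ring.\<close>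
  define b where "b x \<tau> = (if x \<tau> = 1 then \<one>\<^bsub>R\<^esub> else \<zero>\<^bsub>R\<^esub>)" for x :: "nat \<Rightarrow> nat" and \<tau>
  have b: "b x \<tau> \<in> carrier R" for x \<tau>
    by (simp add: b_def)
  define ans where "ans x u = (\<Oplus>\<^bsub>R\<^esub>\<tau>\<in>{1..n}. b x \<tau> \<otimes>\<^bsub>R\<^esub> \<alpha> \<tau> u)" for x u
  define coef where "coef aux = case_prod C (prod_decode (length aux))" for aux :: "bool list"
  \<comment> \<open>The auxiliary string is the pair \<open>(i, l)\<close>, coded in unary.\<close>
  define P :: "('s, 'r, bool list) pir_protocol" where
    "P = \<lparr>query_space = \<lambda>_ _. S, answer_space = \<lambda>_ _. carrier R,
      querying = \<lambda>_ _ i. map_pmf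
        (\<lambda>l. (restrict (Q i l) {1..k}, replicate (prod_encode (i, l)) True)) (pmf_of_set {1..N}),
      answering = \<lambda>_ _. ans,
      reconstructing = \<lambda>_ _ a aux.
        if (\<Oplus>\<^bsub>R\<^esub>j\<in>{1..k}. a j \<otimes>\<^bsub>R\<^esub> coef aux j) = \<zero>\<^bsub>R\<^esub> then 0 else 1\<rparr>"
  \<comment> \<open>The support of \<open>pmf_of_set\<close> is known for finite nonempty sets,
    whence \<open>N > 0\<close>.\<close>
  have set_q: "set_pmf (querying P k n i) =
      (\<lambda>l. (restrict (Q i l) {1..k}, replicate (prod_encode (i, l)) True)) ` {1..N}" for i
    using \<open>N > 0\<close> by (simp add: P_def)
  have ans: "ans x u \<in> carrier R" if "u \<in> S" for x u
    unfolding ans_def using \<alpha> b that by (auto intro!: finsum_closed)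
  have "pir_well_typed P k n"
    unfolding pir_well_typed_def set_q using assms(6,9) QS ans by (auto simp: P_def)
  moreover have "pir_correct P k n"
  proof -
    have "reconstructing P k n (\<lambda>j\<in>{1..k}. answering P k j x (restrict (Q i l) {1..k} j))
        (replicate (prod_encode (i, l)) True) = x i"
      if x: "x \<in> databases n" and i: "i \<in> {1..n}" and l: "l \<in> {1..N}" for x i l
    proof -
      obtain w where w: "w \<in> carrier R" "w \<noteq> \<zero>\<^bsub>R\<^esub>" and
        span: "\<And>\<tau>. \<tau> \<in> {1..n} \<Longrightarrow> (\<Oplus>\<^bsub>R\<^esub>j\<in>{1..k}. \<alpha> \<tau> (Q i l j) \<otimes>\<^bsub>R\<^esub> C i l j)
                    = w \<otimes>\<^bsub>R\<^esub> (if \<tau> = i then \<one>\<^bsub>R\<^esub> else \<zero>\<^bsub>R\<^esub>)"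
        and c: "C i l \<in> {1..k} \<rightarrow> carrier R"
        using C[OF i l] unfolding spans_def by blast
      \<comment> \<open>Both restrictions, of the answers and of the queries, are invisible for
        \<open>j\<close> in \<open>{1..k}\<close>.\<close>
      have "(\<Oplus>\<^bsub>R\<^esub>j\<in>{1..k}. (\<lambda>j\<in>{1..k}. ans x (restrict (Q i l) {1..k} j)) j \<otimes>\<^bsub>R\<^esub> C i l j)
          = (\<Oplus>\<^bsub>R\<^esub>j\<in>{1..k}. ans x (Q i l j) \<otimes>\<^bsub>R\<^esub> C i l j)"
        using c ans QS[OF i l] by (intro finsum_cong') auto
      also have "\<dots> = b x i \<otimes>\<^bsub>R\<^esub> w"
        unfolding ans_def using i l c w(1) span b \<alpha> QS
        by (intro span_unit_vector_extracts) auto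
      \<comment> \<open>The auxiliary string has length \<open>prod_encode (i, l)\<close>, so
        \<open>coef\<close> decodes it to \<open>C i l\<close>.\<close>
      finally have "reconstructing P k n (\<lambda>j\<in>{1..k}. answering P k j x (restrict (Q i l) {1..k} j))
          (replicate (prod_encode (i, l)) True) = (if b x i \<otimes>\<^bsub>R\<^esub> w = \<zero>\<^bsub>R\<^esub> then 0 else 1)"
        by (simp add: P_def coef_def)
      moreover have "x i \<in> {0, 1}"
        using x i by (auto simp: databases_def)
      ultimately show ?thesis
        using w by (auto simp: b_def)
    qed
    then show ?thesis
      unfolding pir_correct_def set_q by blast
  qed
  moreover have "pir_private P t k n"
    unfolding pir_private_def
  proof (intro ballI allI impI)
    fix i1 i2 T assume i: "i1 \<in> {1..n}" "i2 \<in> {1..n}" and T: "T \<subseteq> {1..k} \<and> card T \<le> t"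
    \<comment> \<open>The projection drops the auxiliary string, which would reveal
      \<open>i\<close>; what the servers in \<open>T\<close> see is a subrow of a uniformly random
      row.\<close>
    have "map_pmf (\<lambda>(q, aux). restrict q T) (querying P k n i)
        = map_pmf (\<lambda>l. restrict (Q i l) T) (pmf_of_set {1..N})" for i
      using T by (simp add: P_def pmf.map_comp o_def restrict_restrict Int_absorb1)
    then show "map_pmf (\<lambda>(q, aux). restrict q T) (querying P k n i1) =
        map_pmf (\<lambda>(q, aux). restrict q T) (querying P k n i2)"
      using orthogonal_array_subrow_distr_eq[OF OA[OF i(1)] OA[OF i(2)] \<open>N > 0\<close>] T by simp
  qed
  ultimately have "is_pir t k n P"
    by (simp add: is_pir_def)
  moreover have "query_space P k n = S" "answer_space P k n = carrier R"
    by (simp_all add: P_def)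
  ultimately show ?thesis
    using communication_complexity_eq[OF \<open>n > 0\<close>, of P k] by auto
qed

end
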